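(* Let $n\ge 1$ and let $A$ and $B$ be Hermitian (complex) $n\times n$ matrices such that $A$ is positive semidefinite, and suppose that the polynomial $\eta(zA,-B)$ in $z$ is not identically zero. Then for every $1\le j\le n$ the zeros of $\eta(zA[\{j\}'],-B[\{j\}'])$ interlace those of $\eta(zA,-B)$.
   Context: For an $n\times n$ matrix $A$ and $\mathcal{S}\subseteq\{1,\ldots,n\}$, $A[\mathcal{S}]$ denotes the $|\mathcal{S}|\times|\mathcal{S}|$ principal submatrix of $A$ with rows and columns indexed by $\mathcal{S}$, $\mathcal{S}'$ denotes the complement of $\mathcal{S}$ in $\{1,\ldots,n\}$, and by convention $\det(A[\emptyset])=1$. For $n\times n$ matrices $A,B$ define $$\eta(A,B)=\sum_{\mathcal{S}\subseteq\{1,\ldots,n\}}\det(A[\mathcal{S}])\det(B[\mathcal{S}']),$$ (for $0\times 0$ matrices, $\eta=1$). A nonzero univariate real polynomial is hyperbolic if all its zeros are real. Let $\alpha_1\le\alpha_2\le\cdots\le\alpha_p$ and $\beta_1\le\beta_2\le\cdots\le\beta_q$ be the zeros (with multiplicity) of two hyperbolic polynomials. These zeros are interlaced (the zeros of one polynomial interlace those of the other) if all of them can be arranged in an alternating chain, either $\alpha_1\le\beta_1\le\alpha_2\le\beta_2\le\cdots$ or $\beta_1\le\alpha_1\le\beta_2\le\alpha_2\le\cdots$ (in particular $|p-q|\le 1$). By convention, the zeros of the zero polynomial interlace the zeros of any hyperbolic polynomial. *)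

theory Defs
  imports
    Complex_Main
    "HOL-Computational_Algebra.Polynomial"
    "HOL-Library.Multiset"
    "Jordan_Normal_Form.Determinant"
    "Jordan_Normal_Form.DL_Submatrix"
    "Jordan_Normal_Form.Schur_Decomposition"
begin

(* Matrix indices start at 0, so the index set {1,...,n} is {0..<n}. *)

definition principal_submatrix :: "'a mat \<Rightarrow> nat set \<Rightarrow> 'a mat" where
  "principal_submatrix A S = submatrix A S S"

(* Meant for square matrices A and B of the same size. *)
definition eta :: "'a::comm_ring_1 mat \<Rightarrow> 'a mat \<Rightarrow> 'a" where
  "eta A B = (\<Sum>S\<in>Pow {0..<dim_row A}.
     det (principal_submatrix A S) * det (principal_submatrix B ({0..<dim_row A} - S)))"

(* eta (z A) (- B), as a polynomial in the indeterminate z = monom 1 1. *)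
definition eta_pencil :: "'a::comm_ring_1 mat \<Rightarrow> 'a mat \<Rightarrow> 'a poly" where
  "eta_pencil A B = eta (monom 1 1 \<cdot>\<^sub>m map_mat (\<lambda>a. [:a:]) A) (map_mat (\<lambda>b. [:b:]) (- B))"

definition hermitian :: "complex mat \<Rightarrow> bool" where
  "hermitian A \<longleftrightarrow> mat_adjoint A = A"

(* For Hermitian A the quadratic form is real-valued, so Re loses nothing. *)
definition positive_semidefinite :: "complex mat \<Rightarrow> bool" where
  "positive_semidefinite A \<longleftrightarrow>
     hermitian A \<and> (\<forall>v\<in>carrier_vec (dim_row A). 0 \<le> Re ((A *\<^sub>v v) \<bullet>c v))"

definition hyperbolic :: "real poly \<Rightarrow> bool" where
  "hyperbolic p \<longleftrightarrow> p \<noteq> 0 \<and> (\<forall>z. poly (map_poly complex_of_real p) z = 0 \<longrightarrow> z \<in> \<real>)"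

definition sorted_zeros :: "real poly \<Rightarrow> real list" where
  "sorted_zeros p = sorted_list_of_multiset (proots p)"

(* as!0 <= bs!0 <= as!1 <= bs!1 <= ..., using up both lists. *)
definition alternating_chain :: "real list \<Rightarrow> real list \<Rightarrow> bool" where
  "alternating_chain as bs \<longleftrightarrow>
     (length as = length bs \<or> length as = Suc (length bs)) \<and>
     (\<forall>i<length bs. as ! i \<le> bs ! i) \<and>
     (\<forall>i. Suc i < length as \<longrightarrow> bs ! i \<le> as ! Suc i)"

(* The first two disjuncts are the convention that the zeros of the zero
   polynomial interlace those of any hyperbolic polynomial. *)
definition zeros_interlace :: "real poly \<Rightarrow> real poly \<Rightarrow> bool" where
  "zeros_interlace p q \<longleftrightarrow>
     (p = 0 \<and> hyperbolic q) \<or> (hyperbolic p \<and> q = 0) \<or>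
     (hyperbolic p \<and> hyperbolic q \<and>
       (alternating_chain (sorted_zeros p) (sorted_zeros q) \<or>
        alternating_chain (sorted_zeros q) (sorted_zeros p)))"

end

(* Write P(z) = eta(zA, -B) and Q(z) = eta(zA[{j}'], -B[{j}']).  Since eta is affine in every diagonal
   entry, P + wQ = eta(zA, -B + w E_jj).

   Call a matrix dissipative if its imaginary part (M - M^* )/2i is positive definite.  The key fact is
   that eta(M, N) is nonzero for dissipative M and N.  It is proved one index at a time: the expression
   in which the index i is forced into both of the complementary determinants, evaluated at
   M + t E_ii and N + t E_ii, is a quadratic a + (b + c) t + d t^2 that by induction has no zeros with
   Im t >= 0 and has d nonzero, so b + c is nonzero.

   For Im z > 0 and Im w >= 0 the matrices zA + ieI and -B + ieI + w E_jj are dissipative.  Letting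
   e tend to 0 gives Im (P/Q) >= 0 on the upper half plane, and Hurwitz's theorem shows that P and Q
   are real-rooted or zero.  Interlacing follows from the argument of P/Q: along a horizontal line in
   the upper half plane it varies by at most pi, and close to the real axis it is, up to a constant,
   -pi times the number of zeros of P minus the number of zeros of Q to the left of the point.  So
   this difference takes values in {0, 1} or in {-1, 0}. *)

theory Submission
  imports Defs "HOL-Complex_Analysis.Great_Picard"
begin

section \<open>Principal minors as sums over permutations\<close>

text \<open>Indexing by subsets of the original index set avoids the renumbering that is built into
  \<^const>\<open>principal_submatrix\<close>.\<close>

definition pdet :: "(nat \<Rightarrow> nat \<Rightarrow> 'a::comm_ring_1) \<Rightarrow> nat set \<Rightarrow> 'a" where
  "pdet M S = (\<Sum>p | p permutes S. of_int (sign p) * (\<Prod>i\<in>S. M i (p i)))"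

definition mixdet ::
  "(nat \<Rightarrow> nat \<Rightarrow> 'a::comm_ring_1) \<Rightarrow> (nat \<Rightarrow> nat \<Rightarrow> 'a) \<Rightarrow> nat set \<Rightarrow> 'a" where
  "mixdet M N V = (\<Sum>S\<in>Pow V. pdet M S * pdet N (V - S))"

lemma pdet_cong:
  assumes "\<And>i k. i \<in> S \<Longrightarrow> k \<in> S \<Longrightarrow> M i k = N i k"
  shows "pdet M S = pdet N S"
  unfolding pdet_def by (intro sum.cong prod.cong arg_cong2[of _ _ _ _ "(*)"] refl)
    (auto simp: assms permutes_in_image)

text \<open>Conjugation by \<open>f\<close> carries the permutations of \<open>S\<close> to those of
  \<open>T\<close> and preserves signs.\<close>

lemma pdet_reindex:
  assumes f: "bij_betw f S T" and S: "finite S"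
  shows "pdet (\<lambda>i k. M (f i) (f k)) S = pdet M T"
proof -
  have inj: "inj_on f S" and T: "T = f ` S"
    using f by (auto simp: bij_betw_def)
  have f': "bij_betw (inv_into S f) T S"
    using f by (rule bij_betw_inv_into)
  have injT: "inj_on (inv_into S f) T" using f' by (auto simp: bij_betw_def)
  show ?thesis unfolding pdet_def
  proof (rule sum.reindex_bij_witness[where i = "map_permutation T (inv_into S f)"
        and j = "map_permutation S f"])
    fix p assume "p \<in> {p. p permutes S}"
    then have p: "p permutes S" by simp
    show "map_permutation T (inv_into S f) (map_permutation S f p) = p"
      using f p by (rule map_permutation_compose_inv) (simp add: inj)
    show "map_permutation S f p \<in> {p. p permutes T}"
      using map_permutation_permutes[OF f p] by simp
    have "(\<Prod>i\<in>T. M i (map_permutation S f p i)) = (\<Prod>i\<in>S. M (f i) (map_permutation S f p (f i)))"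
      unfolding T by (simp add: prod.reindex[OF inj])
    also have "\<dots> = (\<Prod>i\<in>S. M (f i) (f (p i)))"
      by (intro prod.cong refl) (simp add: map_permutation_apply[OF inj])
    finally show "of_int (sign (map_permutation S f p)) * (\<Prod>i\<in>T. M i (map_permutation S f p i)) =
      of_int (sign p) * (\<Prod>i\<in>S. M (f i) (f (p i)))"
      by (simp add: sign_map_permutation[OF inj p S])
  next
    fix p assume "p \<in> {p. p permutes T}"
    then have p: "p permutes T" by simp
    show "map_permutation S f (map_permutation T (inv_into S f) p) = p"
      using f' p by (rule map_permutation_compose_inv) (simp add: T f_inv_into_f)
    show "map_permutation T (inv_into S f) p \<in> {p. p permutes S}"
      using map_permutation_permutes[OF f' p] by simp
  qed
qed

lemma mixdet_reindex:
  assumes f: "bij_betw f V W" and V: "finite V"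
  shows "mixdet (\<lambda>i k. M (f i) (f k)) (\<lambda>i k. N (f i) (f k)) V = mixdet M N W"
proof -
  have inj: "inj_on f V" and W: "W = f ` V"
    using f by (auto simp: bij_betw_def)
  have "mixdet M N W = (\<Sum>S\<in>Pow V. pdet M (f ` S) * pdet N (W - f ` S))"
    unfolding mixdet_def W image_Pow_surj[OF refl, symmetric]
    using inj by (subst sum.reindex) (auto intro: inj_on_image_Pow)
  also have "\<dots> = mixdet (\<lambda>i k. M (f i) (f k)) (\<lambda>i k. N (f i) (f k)) V"
    unfolding mixdet_def
  proof (intro sum.cong refl arg_cong2[of _ _ _ _ "(*)"])
    fix S assume S: "S \<in> Pow V"
    have "bij_betw f S (f ` S)" using S inj by (auto simp: bij_betw_def inj_on_subset)
    then show "pdet M (f ` S) = pdet (\<lambda>i k. M (f i) (f k)) S"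
      using pdet_reindex[of f S "f ` S" M] finite_subset[of S V] S V by simp
    have "W - f ` S = f ` (V - S)"
      using S inj unfolding W by (auto simp: inj_on_def)
    moreover have "bij_betw f (V - S) (f ` (V - S))"
      using S inj by (auto simp: bij_betw_def inj_on_diff)
    ultimately show "pdet N (W - f ` S) = pdet (\<lambda>i k. N (f i) (f k)) (V - S)"
      using pdet_reindex[of f "V - S" "f ` (V - S)" N] V by auto
  qed
  finally show ?thesis by simp
qed

section \<open>Translation of \<open>principal_submatrix\<close> and \<open>eta\<close> into
  \<open>pdet\<close> and \<open>mixdet\<close>\<close>

lemma bij_betw_pick:
  assumes S: "finite S"
  shows "bij_betw (pick S) {0..<card S} S"
proof (rule bij_betwI[where g = "\<lambda>i. card {a \<in> S. a < i}"])
  show "pick S \<in> {0..<card S} \<rightarrow> S" by (auto simp: pick_in_set_le)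
  show "(\<lambda>i. card {a \<in> S. a < i}) \<in> S \<rightarrow> {0..<card S}"
    using S by (auto intro!: psubset_card_mono)
  show "card {a \<in> S. a < pick S i} = i" if "i \<in> {0..<card S}" for i
    using that card_pick[of i S] by auto
  show "pick S (card {a \<in> S. a < i}) = i" if "i \<in> S" for i
    using that by (rule pick_card_in_set)
qed

lemma principal_submatrix_carrier:
  assumes "A \<in> carrier_mat n n" "S \<subseteq> {0..<n}"
  shows "principal_submatrix A S \<in> carrier_mat (card S) (card S)"
    and "i < card S \<Longrightarrow> k < card S \<Longrightarrow> principal_submatrix A S $$ (i, k) = A $$ (pick S i, pick S k)"
proof -
  have *: "{i. i < n \<and> i \<in> S} = S" using assms by auto
  show "principal_submatrix A S \<in> carrier_mat (card S) (card S)"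
    using assms * by (auto simp: principal_submatrix_def dim_submatrix)
  show "i < card S \<Longrightarrow> k < card S \<Longrightarrow> principal_submatrix A S $$ (i, k) = A $$ (pick S i, pick S k)"
    using assms * by (auto simp: principal_submatrix_def submatrix_index)
qed

lemma det_principal_submatrix:
  assumes A: "A \<in> carrier_mat n n" and S: "S \<subseteq> {0..<n}"
  shows "Determinant.det (principal_submatrix A S) = pdet (\<lambda>i k. A $$ (i, k)) S"
proof -
  have fin: "finite S" using S finite_subset by blast
  have "Determinant.det (principal_submatrix A S) =
      pdet (\<lambda>i k. principal_submatrix A S $$ (i, k)) {0..<card S}"
    unfolding det_def'[OF principal_submatrix_carrier(1)[OF A S]] pdet_def
    by (intro sum.cong refl)
  also have "\<dots> = pdet (\<lambda>i k. A $$ (pick S i, pick S k)) {0..<card S}"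
    by (rule pdet_cong) (simp add: principal_submatrix_carrier(2)[OF A S])
  also have "\<dots> = pdet (\<lambda>i k. A $$ (i, k)) S"
    by (rule pdet_reindex[OF bij_betw_pick[OF fin]]) simp
  finally show ?thesis .
qed

lemma eta_eq_mixdet:
  assumes A: "A \<in> carrier_mat n n" and B: "B \<in> carrier_mat n n"
  shows "eta A B = mixdet (\<lambda>i k. A $$ (i, k)) (\<lambda>i k. B $$ (i, k)) {0..<n}"
proof -
  have n: "dim_row A = n" using A by simp
  show ?thesis unfolding eta_def mixdet_def n
    by (intro sum.cong refl arg_cong2[of _ _ _ _ "(*)"])
      (auto simp: det_principal_submatrix[OF A] det_principal_submatrix[OF B])
qed

lemma of_int_sign_pCons: "of_int (sign p) * [:a:] = [:of_int (sign p) * a:]"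
  by (simp add: sign_def)

lemma pdet_pCons: "pdet (\<lambda>i k. [:M i k:]) S = [:pdet M S:]"
proof -
  have *: "(\<Prod>i\<in>S. [:M i (p i):]) = [:\<Prod>i\<in>S. M i (p i):]" for p
    by (induction S rule: infinite_finite_induct) auto
  have **: "(\<Sum>p\<in>X. [:f p:]) = [:\<Sum>p\<in>X. f p:]" for f :: "_ \<Rightarrow> 'a" and X :: "(nat \<Rightarrow> nat) set"
    by (induction X rule: infinite_finite_induct) auto
  show ?thesis unfolding pdet_def * of_int_sign_pCons ** ..
qed

lemma pdet_scale: "pdet (\<lambda>i k. c * M i k) S = c ^ card S * pdet M S"
  unfolding pdet_def
  by (simp add: prod.distrib sum_distrib_left mult.left_commute)

lemma eta_pencil_eq_mixdet:
  assumes A: "A \<in> carrier_mat n n" and B: "B \<in> carrier_mat n n"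
  shows "eta_pencil A B =
    mixdet (\<lambda>i k. monom 1 1 * [:A $$ (i, k):]) (\<lambda>i k. [:- B $$ (i, k):]) {0..<n}"
  unfolding eta_pencil_def mixdet_def
  by (subst eta_eq_mixdet[of _ n])
    (use A B in \<open>auto simp: mixdet_def subset_iff intro!: sum.cong arg_cong2[of _ _ _ _ "(*)"] pdet_cong\<close>)

text \<open>Each minor of zA indexed by \<open>S\<close> contributes the factor z^|S|. Keeping
  \<open>V\<close> arbitrary covers both polynomials of the theorem at once: the full index set, and
  the index set without j.\<close>

lemma eta_pencil_principal_submatrix:
  assumes A: "A \<in> carrier_mat n n" and B: "B \<in> carrier_mat n n" and V: "V \<subseteq> {0..<n}"
  shows "eta_pencil (principal_submatrix A V) (principal_submatrix B V) =
    (\<Sum>S\<in>Pow V. monom (pdet (\<lambda>i k. A $$ (i, k)) S * pdet (\<lambda>i k. - B $$ (i, k)) (V - S)) (card S))"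
proof -
  have fin: "finite V" using V finite_subset by blast
  let ?f = "pick V"
  have "eta_pencil (principal_submatrix A V) (principal_submatrix B V) =
      mixdet (\<lambda>i k. monom 1 1 * [:principal_submatrix A V $$ (i, k):])
        (\<lambda>i k. [:- principal_submatrix B V $$ (i, k):]) {0..<card V}"
    by (rule eta_pencil_eq_mixdet[OF principal_submatrix_carrier(1)[OF A V] principal_submatrix_carrier(1)[OF B V]])
  also have "\<dots> = mixdet (\<lambda>i k. monom 1 1 * [:A $$ (?f i, ?f k):]) (\<lambda>i k. [:- B $$ (?f i, ?f k):]) {0..<card V}"
    unfolding mixdet_def
    by (intro sum.cong refl arg_cong2[of _ _ _ _ "(*)"] pdet_cong)
      (auto simp: principal_submatrix_carrier(2)[OF A V] principal_submatrix_carrier(2)[OF B V] subset_iff)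
  also have "\<dots> = mixdet (\<lambda>i k. monom 1 1 * [:A $$ (i, k):]) (\<lambda>i k. [:- B $$ (i, k):]) V"
    using bij_betw_pick[OF fin] finite_atLeastLessThan
    by (rule mixdet_reindex)
  also have "\<dots> = (\<Sum>S\<in>Pow V. monom (pdet (\<lambda>i k. A $$ (i, k)) S * pdet (\<lambda>i k. - B $$ (i, k)) (V - S)) (card S))"
    unfolding mixdet_def pdet_scale pdet_pCons
    by (intro sum.cong refl) (simp add: monom_power smult_monom mult_monom ac_simps)
  finally show ?thesis .
qed

text \<open>The entry at (j, j) occurs only in the terms of permutations that fix \<open>j\<close>,
  and these are exactly the permutations of \<open>S\<close>.\<close>

lemma pdet_insert_diag:
  assumes j: "j \<notin> S" and S: "finite S"
  shows "pdet (\<lambda>i k. M i k + (if i = j \<and> k = j then x else 0)) (insert j S) =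
    pdet M (insert j S) + x * pdet M S"
proof -
  let ?M = "\<lambda>i k. M i k + (if i = j \<and> k = j then x else 0)"
  let ?P = "{p. p permutes insert j S}"
  have fin: "finite ?P" using S by (simp add: finite_permutations)
  have "(\<Prod>i\<in>insert j S. ?M i (p i)) = (\<Prod>i\<in>insert j S. M i (p i)) +
      (if p j = j then x * (\<Prod>i\<in>S. M i (p i)) else 0)" for p
  proof -
    have "(\<Prod>i\<in>S. ?M i (p i)) = (\<Prod>i\<in>S. M i (p i))"
      using j by (intro prod.cong) auto
    then show ?thesis using j S by (simp add: algebra_simps)
  qed
  then have "pdet ?M (insert j S) = pdet M (insert j S) +
      (\<Sum>p\<in>?P. of_int (sign p) * (if p j = j then x * (\<Prod>i\<in>S. M i (p i)) else 0))"
    unfolding pdet_def by (simp add: algebra_simps sum.distrib)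
  also have "(\<Sum>p\<in>?P. of_int (sign p) * (if p j = j then x * (\<Prod>i\<in>S. M i (p i)) else 0)) =
      (\<Sum>p\<in>{p\<in>?P. p j = j}. of_int (sign p) * (x * (\<Prod>i\<in>S. M i (p i))))"
    using fin by (intro sum.mono_neutral_cong_right) auto
  also have "{p\<in>?P. p j = j} = {p. p permutes S}"
    using j by (auto simp: permutes_def)
  finally show ?thesis
    by (simp add: pdet_def sum_distrib_left mult.left_commute)
qed

section \<open>Dissipative matrices\<close>

definition dissipative :: "(nat \<Rightarrow> nat \<Rightarrow> complex) \<Rightarrow> nat set \<Rightarrow> bool" where
  "dissipative M U \<longleftrightarrow> (\<forall>v. (\<exists>i\<in>U. v i \<noteq> 0) \<longrightarrow>
     0 < Im (\<Sum>i\<in>U. \<Sum>k\<in>U. cnj (v i) * M i k * v k))"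

text \<open>A vector on \<open>W\<close> is extended by zero to \<open>U\<close>, which does not
  change the value of the form.\<close>

lemma dissipative_subset:
  assumes M: "dissipative M U" and W: "W \<subseteq> U" and U: "finite U"
  shows "dissipative M W"
  unfolding dissipative_def
proof (intro allI impI)
  fix v :: "nat \<Rightarrow> complex" assume v: "\<exists>i\<in>W. v i \<noteq> 0"
  define u where "u = (\<lambda>i. if i \<in> W then v i else 0)"
  have "\<exists>i\<in>U. u i \<noteq> 0" using v W by (auto simp: u_def)
  then have "0 < Im (\<Sum>i\<in>U. \<Sum>k\<in>U. cnj (u i) * M i k * u k)"
    using M unfolding dissipative_def by blast
  also have "(\<Sum>i\<in>U. \<Sum>k\<in>U. cnj (u i) * M i k * u k) = (\<Sum>i\<in>W. \<Sum>k\<in>U. cnj (u i) * M i k * u k)"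
    using U W by (intro sum.mono_neutral_right) (auto simp: u_def)
  also have "\<dots> = (\<Sum>i\<in>W. \<Sum>k\<in>W. cnj (u i) * M i k * u k)"
    using U W by (intro sum.cong refl sum.mono_neutral_right) (auto simp: u_def)
  also have "\<dots> = (\<Sum>i\<in>W. \<Sum>k\<in>W. cnj (v i) * M i k * v k)"
    by (intro sum.cong refl) (auto simp: u_def)
  finally show "0 < Im (\<Sum>i\<in>W. \<Sum>k\<in>W. cnj (v i) * M i k * v k)" .
qed

text \<open>The change adds x |v_j|^2 to the form, so its imaginary part cannot decrease.\<close>

lemma dissipative_add_diag:
  assumes M: "dissipative M U" and U: "finite U" and x: "0 \<le> Im x"
  shows "dissipative (\<lambda>i k. M i k + (if i = j \<and> k = j then x else 0)) U"
  unfolding dissipative_def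
proof (intro allI impI)
  fix v :: "nat \<Rightarrow> complex" assume v: "\<exists>i\<in>U. v i \<noteq> 0"
  have "(\<Sum>i\<in>U. \<Sum>k\<in>U. cnj (v i) * (M i k + (if i = j \<and> k = j then x else 0)) * v k) =
    (\<Sum>i\<in>U. \<Sum>k\<in>U. cnj (v i) * M i k * v k) +
    (\<Sum>i\<in>U. \<Sum>k\<in>U. if k = j then if i = j then cnj (v i) * x * v k else 0 else 0)"
    unfolding sum.distrib[symmetric] by (intro sum.cong refl) (auto simp: algebra_simps)
  also have "(\<Sum>i\<in>U. \<Sum>k\<in>U. if k = j then if i = j then cnj (v i) * x * v k else 0 else 0) =
      (if j \<in> U then x * of_real ((cmod (v j))\<^sup>2) else 0)"
    using U by (simp add: complex_norm_square mult_ac del: of_real_power)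
  finally show "0 < Im (\<Sum>i\<in>U. \<Sum>k\<in>U. cnj (v i) * (M i k + (if i = j \<and> k = j then x else 0)) * v k)"
    using M v x unfolding dissipative_def by (auto simp: add_pos_nonneg simp del: of_real_power)
qed

text \<open>A nonzero kernel vector would make the quadratic form vanish, against positivity of its
  imaginary part.\<close>

lemma pdet_dissipative_nonzero:
  assumes M: "dissipative M U" and U: "finite U"
  shows "pdet M U \<noteq> 0"
proof
  assume 0: "pdet M U = 0"
  let ?m = "card U" and ?f = "pick U"
  have f: "bij_betw ?f {0..<?m} U" using U by (rule bij_betw_pick)
  \<comment> \<open>The criterion that yields a kernel vector concerns matrices indexed from 0, so
    \<open>M\<close> is renumbered along \<open>pick U\<close> and the vector is carried back
    afterwards.\<close>
  let ?A = "Matrix.mat ?m ?m (\<lambda>(i, k). M (?f i) (?f k))"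
  have A: "?A \<in> carrier_mat ?m ?m" by simp
  have "Determinant.det ?A = pdet (\<lambda>i k. M (?f i) (?f k)) {0..<?m}"
    unfolding det_def'[OF A] pdet_def
  proof (intro sum.cong refl arg_cong2[of _ _ _ _ "(*)"] prod.cong)
    fix p i assume p: "p \<in> {p. p permutes {0..<?m}}" and i: "i \<in> {0..<?m}"
    then have "p i < ?m" using permutes_in_image[of p "{0..<?m}" i] by auto
    then show "?A $$ (i, p i) = M (?f i) (?f (p i))" using i by simp
  qed
  also have "\<dots> = 0" using pdet_reindex[OF f, of M] 0 by simp
  finally obtain v where v: "v \<in> carrier_vec ?m" "v \<noteq> 0\<^sub>v ?m" "?A *\<^sub>v v = 0\<^sub>v ?m"
    using det_0_iff_vec_prod_zero[OF A] by auto
  define g where "g = inv_into {0..<?m} ?f"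
  have g: "g (?f i) = i" if "i < ?m" for i
    using f that by (simp add: g_def bij_betw_def)
  define u where "u = (\<lambda>s. v $ g s)"
  have row: "(\<Sum>k\<in>U. M s k * u k) = 0" if s: "s \<in> U" for s
  proof -
    have "s \<in> ?f ` {0..<?m}" using f s by (simp add: bij_betw_def)
    then obtain i where i: "i < ?m" "s = ?f i" by auto
    have "(\<Sum>k\<in>U. M s k * u k) = (\<Sum>k\<in>{0..<?m}. M s (?f k) * u (?f k))"
      using sum.reindex_bij_betw[OF f, of "\<lambda>k. M s k * u k"] by simp
    also have "\<dots> = (?A *\<^sub>v v) $ i"
      using i v(1) by (auto simp: scalar_prod_def u_def g intro!: sum.cong)
    finally show ?thesis using v(3) i by simp
  qed
  obtain i where i: "i < ?m" "v $ i \<noteq> 0"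
    using v(1,2) by (metis carrier_vecD eq_vecI index_zero_vec(1) index_zero_vec(2))
  then have "\<exists>s\<in>U. u s \<noteq> 0"
    using f by (intro bexI[of _ "?f i"]) (auto simp: u_def g bij_betw_def)
  then have "0 < Im (\<Sum>i\<in>U. \<Sum>k\<in>U. cnj (u i) * M i k * u k)"
    using M by (auto simp: dissipative_def)
  also have "(\<Sum>i\<in>U. \<Sum>k\<in>U. cnj (u i) * M i k * u k) = (\<Sum>i\<in>U. cnj (u i) * (\<Sum>k\<in>U. M i k * u k))"
    by (simp add: sum_distrib_left mult.assoc)
  also have "\<dots> = 0" by (simp add: row)
  finally show False by simp
qed

section \<open>Nonvanishing of \<open>mixdet\<close> on pairs of dissipative matrices\<close>

lemma sum_Pow_insert:
  assumes "j \<notin> V" "finite V"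
  shows "(\<Sum>S\<in>Pow (insert j V). F S) = (\<Sum>S\<in>Pow V. F S) + (\<Sum>S\<in>Pow V. F (insert j S))"
proof -
  have "inj_on (insert j) (Pow V)" using assms by (auto simp: inj_on_def)
  moreover have "Pow V \<inter> insert j ` Pow V = {}" using assms by auto
  ultimately show ?thesis
    using assms by (simp add: Pow_insert sum.union_disjoint sum.reindex)
qed

text \<open>If b + c = 0, the quadratic is a + d t^2; its roots are negatives of each other, so one
  of them has nonnegative imaginary part.\<close>

lemma bilinear_pencil_nonzero:
  fixes a b c d :: complex
  assumes nz: "\<And>t. 0 \<le> Im t \<Longrightarrow> a + b * t + c * t + d * t * t \<noteq> 0" and d: "d \<noteq> 0"
  shows "b + c \<noteq> 0"
proof
  assume bc: "b + c = 0"
  define t where "t = (if 0 \<le> Im (csqrt (- a / d)) then csqrt (- a / d) else - csqrt (- a / d))"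
  have "t\<^sup>2 = - a / d" by (simp add: t_def)
  then have "d * t * t = - a" using d by (simp add: power2_eq_square field_simps)
  moreover have "b * t + c * t = 0" using bc by (simp flip: distrib_right)
  ultimately have "a + b * t + c * t + d * t * t = 0" by (simp add: add.assoc)
  moreover have "0 \<le> Im t" by (simp add: t_def)
  ultimately show False using nz by blast
qed

text \<open>In the induction step the index taken out of \<open>V\<close> moves into both of \<open>W1\<close> and \<open>W2\<close>, into one
  of them, or into neither; hence the two sets are independent of each other.\<close>

lemma mixdet_dissipative_nonzero_aux:
  assumes "finite V" "finite U" "V \<inter> W1 = {}" "V \<inter> W2 = {}" "V \<union> W1 \<union> W2 \<subseteq> U"
    and "dissipative M U" "dissipative N U"
  shows "(\<Sum>S\<in>Pow V. pdet M (W1 \<union> S) * pdet N (W2 \<union> (V - S))) \<noteq> 0"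
  using assms
proof (induction V arbitrary: M N W1 W2 rule: finite_induct)
  case empty
  then have "dissipative M W1" "dissipative N W2" "finite W1" "finite W2"
    using dissipative_subset finite_subset by auto
  then show ?case by (auto simp: pdet_dissipative_nonzero)
next
  case (insert j V)
  let ?F = "\<lambda>M N W1 W2. \<Sum>S\<in>Pow V. pdet M (W1 \<union> S) * pdet N (W2 \<union> (V - S))"
  let ?d = "\<lambda>M x i k. M i k + (if i = j \<and> k = j then x else (0::complex))"
  \<comment> \<open>The index \<open>j\<close> is forced into both minors in \<open>?a\<close>, only
    into that of \<open>N\<close> in \<open>?b\<close>, only into that of \<open>M\<close> in
    \<open>?c\<close>, and into neither in \<open>?e\<close>. The sum to be shown nonzero is
    \<open>?b + ?c\<close>.\<close>
  let ?a = "?F M N (insert j W1) (insert j W2)" and ?b = "?F M N W1 (insert j W2)"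
    and ?c = "?F M N (insert j W1) W2" and ?e = "?F M N W1 W2"
  have fin: "finite W1" "finite W2" using insert.prems finite_subset by auto
  have jW: "j \<notin> W1" "j \<notin> W2" using insert.prems by auto
  have e: "?e \<noteq> 0" using insert.prems by (intro insert.IH) auto
  have "?a + ?b * t + ?c * t + ?e * t * t \<noteq> 0" if t: "0 \<le> Im t" for t
  proof -
    \<comment> \<open>The induction hypothesis is used for the matrices shifted by \<open>t\<close>
      at (j, j), with \<open>j\<close> in both sets; expanding each minor in \<open>t\<close>
      produces the quadratic.\<close>
    have "?F (?d M t) (?d N t) (insert j W1) (insert j W2) \<noteq> 0"
      using insert.prems insert.hyps t by (intro insert.IH dissipative_add_diag) auto
    also have "?F (?d M t) (?d N t) (insert j W1) (insert j W2) =
      (\<Sum>S\<in>Pow V. (pdet M (insert j W1 \<union> S) + t * pdet M (W1 \<union> S)) *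
        (pdet N (insert j W2 \<union> (V - S)) + t * pdet N (W2 \<union> (V - S))))"
    proof (intro sum.cong refl arg_cong2[of _ _ _ _ "(*)"])
      fix S assume S: "S \<in> Pow V"
      then have "finite S" using insert.hyps finite_subset by auto
      then show "pdet (?d M t) (insert j W1 \<union> S) = pdet M (insert j W1 \<union> S) + t * pdet M (W1 \<union> S)"
        using pdet_insert_diag[of j "W1 \<union> S" M t] S fin jW insert.hyps by auto
      show "pdet (?d N t) (insert j W2 \<union> (V - S)) = pdet N (insert j W2 \<union> (V - S)) + t * pdet N (W2 \<union> (V - S))"
        using pdet_insert_diag[of j "W2 \<union> (V - S)" N t] fin jW insert.hyps by auto
    qed
    also have "\<dots> = ?a + ?b * t + ?c * t + ?e * t * t"
      by (simp add: algebra_simps sum.distrib sum_distrib_left)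
    finally show ?thesis .
  qed
  then have "?b + ?c \<noteq> 0" using e by (rule bilinear_pencil_nonzero)
  \<comment> \<open>Subsets without \<open>j\<close> leave \<open>j\<close> to the minor of
    \<open>N\<close>; subsets containing \<open>j\<close> give it to the minor of
    \<open>M\<close>.\<close>
  moreover have "?b = (\<Sum>S\<in>Pow V. pdet M (W1 \<union> S) * pdet N (W2 \<union> (insert j V - S)))"
    using insert.hyps by (intro sum.cong refl arg_cong2[of _ _ _ _ "(*)"] arg_cong[of _ _ "pdet N"]) auto
  moreover have "?c = (\<Sum>S\<in>Pow V. pdet M (W1 \<union> insert j S) * pdet N (W2 \<union> (insert j V - insert j S)))"
    using insert.hyps by (intro sum.cong refl arg_cong2[of _ _ _ _ "(*)"] arg_cong[of _ _ "pdet N"]) auto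
  ultimately show ?case using insert.hyps by (simp add: sum_Pow_insert)
qed

lemma mixdet_dissipative_nonzero:
  assumes "finite V" "dissipative M V" "dissipative N V"
  shows "mixdet M N V \<noteq> 0"
  using mixdet_dissipative_nonzero_aux[of V V "{}" "{}" M N] assms by (simp add: mixdet_def)

text \<open>This is the identity behind P + wQ. A subset containing \<open>j\<close> leaves a minor
  of \<open>N\<close> that does not see the changed entry; for the other subsets
  \<open>pdet_insert_diag\<close> applies.\<close>

lemma mixdet_add_diag:
  assumes V: "finite V" and j: "j \<in> V"
  shows "mixdet M (\<lambda>i k. N i k + (if i = j \<and> k = j then w else 0)) V =
    mixdet M N V + w * mixdet M N (V - {j})"
proof -
  let ?N = "\<lambda>i k. N i k + (if i = j \<and> k = j then w else 0)"
  define V' where "V' = V - {j}"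
  have V': "V = insert j V'" "j \<notin> V'" "finite V'" using V j by (auto simp: V'_def)
  have 1: "(\<Sum>S\<in>Pow V'. pdet M S * pdet K (insert j V' - S)) =
      (\<Sum>S\<in>Pow V'. pdet M S * pdet K (insert j (V' - S)))" for K
    using V' by (intro sum.cong refl arg_cong2[of _ _ _ _ "(*)"] arg_cong[of _ _ "pdet K"]) auto
  have 2: "pdet ?N (insert j V' - insert j S) = pdet N (insert j V' - insert j S)" for S
    by (intro pdet_cong) auto
  have 3: "pdet ?N (insert j (V' - S)) = pdet N (insert j (V' - S)) + w * pdet N (V' - S)" for S
    using V' by (intro pdet_insert_diag) auto
  have "mixdet M ?N V = mixdet M N V + w * mixdet M N V'"
    unfolding mixdet_def V'(1) sum_Pow_insert[OF V'(2,3)] 1 2 3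
    by (simp add: algebra_simps sum.distrib sum_distrib_left)
  then show ?thesis by (simp add: V'_def)
qed

section \<open>Interlacing from the argument of a quotient\<close>

text \<open>Writing the argument in (0, pi) through arctan makes its continuity in \<open>x\<close>
  and its limits for \<open>y\<close> tending to 0 elementary.\<close>

lemma Complex_eq_rcis_arctan:
  assumes y: "0 < y"
  shows "Complex x y = rcis (y * sqrt (1 + (x / y)\<^sup>2)) (pi / 2 - arctan (x / y))"
proof -
  have "0 < sqrt (1 + (x / y)\<^sup>2)" by (simp add: add_pos_nonneg)
  then show ?thesis using y
    by (simp add: complex_eq_iff Re_rcis Im_rcis cos_diff sin_diff sin_arctan cos_arctan)
qed

text \<open>The sum of the arguments in \<open>(0, \<pi>)\<close> of \<open>x + \<i>y - a\<close>, for \<open>y > 0\<close>.\<close>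

definition angle_sum :: "real multiset \<Rightarrow> real \<Rightarrow> real \<Rightarrow> real" where
  "angle_sum A y x = (\<Sum>a\<in>#A. pi / 2 - arctan ((x - a) / y))"

lemma angle_sum_simps [simp]:
  "angle_sum {#} y x = 0"
  "angle_sum (add_mset a A) y x = pi / 2 - arctan ((x - a) / y) + angle_sum A y x"
  by (simp_all add: angle_sum_def)

lemma prod_mset_eq_rcis_angle_sum:
  assumes y: "0 < y"
  shows "\<exists>r>0. (\<Prod>a\<in>#A. Complex x y - of_real a) = rcis r (angle_sum A y x)"
proof (induction A)
  case empty
  show ?case by (auto simp: rcis_def intro: exI[of _ 1])
next
  case (add a A)
  then obtain r where r: "0 < r" "(\<Prod>a\<in>#A. Complex x y - of_real a) = rcis r (angle_sum A y x)"
    by blast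
  define s where "s = y * sqrt (1 + ((x - a) / y)\<^sup>2)"
  have s: "0 < s" using y by (simp add: s_def add_pos_nonneg)
  have "Complex x y - of_real a = rcis s (pi / 2 - arctan ((x - a) / y))"
    using Complex_eq_rcis_arctan[OF y, of "x - a"] by (simp add: s_def complex_eq_iff)
  then show ?case using r s
    by (intro exI[of _ "s * r"]) (simp add: rcis_mult)
qed

lemma continuous_on_angle_sum: "y \<noteq> 0 \<Longrightarrow> continuous_on X (angle_sum A y)"
proof (induction A)
  case empty
  show ?case by (simp add: angle_sum_def)
next
  case (add a A)
  have "continuous_on X (\<lambda>x. pi / 2 - arctan ((x - a) / y) + angle_sum A y x)"
    using add by (intro continuous_intros) auto
  then show ?case by simp
qed

text \<open>Near the real axis the argument is 0 to the right of a zero and pi to the left of it. At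
  x = 0 it would stay at pi / 2.\<close>

lemma tendsto_arctan_divide:
  assumes "x \<noteq> (0::real)"
  shows "((\<lambda>y. pi / 2 - arctan (x / y)) \<longlongrightarrow> (if 0 < x then 0 else pi)) (at_right 0)"
proof (cases "0 < x")
  case True
  have "filterlim (\<lambda>y. x * inverse y) at_top (at_right 0)"
    by (rule filterlim_tendsto_pos_mult_at_top[OF tendsto_const True filterlim_inverse_at_top_right])
  then have "((\<lambda>y. arctan (x / y)) \<longlongrightarrow> pi / 2) (at_right 0)"
    unfolding divide_inverse[symmetric] by (rule filterlim_compose[OF tendsto_arctan_at_top])
  then have "((\<lambda>y. pi / 2 - arctan (x / y)) \<longlongrightarrow> pi / 2 - pi / 2) (at_right 0)"
    by (intro tendsto_intros)
  then show ?thesis using True by simp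
next
  case False
  then have x: "x < 0" using assms by simp
  have "filterlim (\<lambda>y. x * inverse y) at_bot (at_right 0)"
    by (rule filterlim_tendsto_neg_mult_at_bot[OF tendsto_const x filterlim_inverse_at_top_right])
  then have "((\<lambda>y. arctan (x / y)) \<longlongrightarrow> - (pi / 2)) (at_right 0)"
    unfolding divide_inverse[symmetric] by (rule filterlim_compose[OF tendsto_arctan_at_bot])
  then have "((\<lambda>y. pi / 2 - arctan (x / y)) \<longlongrightarrow> pi / 2 - - (pi / 2)) (at_right 0)"
    by (intro tendsto_intros)
  then show ?thesis using False by simp
qed

definition count_le :: "real multiset \<Rightarrow> real \<Rightarrow> nat" where
  "count_le A t = size (filter_mset (\<lambda>a. a \<le> t) A)"

text \<open>In the limit each zero to the right of \<open>t\<close> contributes pi and each zero to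
  the left contributes nothing.\<close>

lemma tendsto_angle_sum:
  assumes "t \<notin># A"
  shows "((\<lambda>y. angle_sum A y t) \<longlongrightarrow> pi * (real (size A) - real (count_le A t))) (at_right 0)"
  using assms
proof (induction A)
  case empty
  show ?case by (simp add: count_le_def)
next
  case (add a A)
  have "((\<lambda>y. pi / 2 - arctan ((t - a) / y) + angle_sum A y t) \<longlongrightarrow>
      (if 0 < t - a then 0 else pi) + pi * (real (size A) - real (count_le A t))) (at_right 0)"
    using add by (intro tendsto_add tendsto_arctan_divide) auto
  moreover have "(if 0 < t - a then 0 else pi) + pi * (real (size A) - real (count_le A t)) =
     pi * (real (size (add_mset a A)) - real (count_le (add_mset a A) t))"
    using add.prems by (auto simp: count_le_def algebra_simps)
  ultimately show ?case by simp
qed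

text \<open>Otherwise the image contains an interval longer than pi. Points of it at distance pi
  have opposite sines, so the sign condition makes the sine vanish on a whole interval of positive
  length.\<close>

lemma sin_sign_imp_variation_le_pi:
  fixes f :: "real \<Rightarrow> real"
  assumes f: "continuous_on {s..t} f" and st: "s \<le> t" and c: "c \<noteq> 0"
    and sgn: "\<And>x. x \<in> {s..t} \<Longrightarrow> 0 \<le> c * sin (f x)"
  shows "\<bar>f s - f t\<bar> \<le> pi"
proof (rule ccontr)
  assume neg: "\<not> \<bar>f s - f t\<bar> \<le> pi"
  define u where "u = min (f s) (f t)"
  define v where "v = max (f s) (f t)"
  have uv: "u + pi < v" using neg by (auto simp: u_def v_def)
  have conn: "connected (f ` {s..t})"
    by (intro connected_continuous_image f) simp
  have "{u..v} \<subseteq> f ` {s..t}"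
    using st by (intro connected_contains_Icc[OF conn]) (auto simp: u_def v_def min_def max_def)
  then have sgn': "0 \<le> c * sin w" if "u \<le> w" "w \<le> v" for w
    using sgn that by (metis atLeastAtMost_iff imageE subsetD)
  have sin0: "sin w = 0" if "u \<le> w" "w + pi \<le> v" for w
  proof -
    have "0 \<le> c * sin w" "0 \<le> - (c * sin w)"
      using sgn'[of w] sgn'[of "w + pi"] that pi_ge_zero by auto
    then show ?thesis using c by simp
  qed
  \<comment> \<open>Small enough that \<open>u + d\<close> is still a point where the sine is known
    to vanish, and within (0, pi), where sin d > 0.\<close>
  define d where "d = min 1 (v - u - pi)"
  have d: "0 < d" "d \<le> 1" "d < pi" using uv pi_gt3 by (auto simp: d_def)
  have "sin u = 0" "sin (u + d) = 0"
    using sin0[of u] sin0[of "u + d"] uv d by (auto simp: d_def)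
  moreover have "sin d = sin (u + d) * cos u - cos (u + d) * sin u"
    using sin_diff[of "u + d" u] by simp
  ultimately have "sin d = 0" by simp
  then show False using sin_gt_zero[of d] d by simp
qed

section \<open>Counting functions and alternating chains\<close>

lemma nth_sorted_le_iff:
  "sorted xs \<Longrightarrow> k < length xs \<Longrightarrow> xs ! k \<le> (t::real) \<longleftrightarrow> k < length (filter (\<lambda>a. a \<le> t) xs)"
proof (induction xs arbitrary: k)
  case (Cons x xs)
  show ?case
  proof (cases "x \<le> t")
    case True
    then show ?thesis using Cons by (cases k) auto
  next
    case False
    then have "\<forall>a\<in>set (x # xs). \<not> a \<le> t" using Cons.prems(1) by auto
    moreover have "(x # xs) ! k \<in> set (x # xs)" using Cons.prems(2) nth_mem by blast
    ultimately show ?thesis by (metis filter_False less_zeroE list.size(3))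
  qed
qed simp

text \<open>The entries of a sorted list that are at most \<open>t\<close> form a prefix. This turns
  interlacing into inequalities between counting functions.\<close>

lemma nth_sorted_list_of_multiset_le_iff:
  assumes "k < size A"
  shows "sorted_list_of_multiset A ! k \<le> t \<longleftrightarrow> k < count_le A t"
proof -
  have "length (filter (\<lambda>a. a \<le> t) (sorted_list_of_multiset A)) = count_le A t"
    unfolding count_le_def by (metis mset_filter mset_sorted_list_of_multiset size_mset)
  moreover have "length (sorted_list_of_multiset A) = size A"
    by (metis mset_sorted_list_of_multiset size_mset)
  ultimately show ?thesis using assms nth_sorted_le_iff[of "sorted_list_of_multiset A" k t] by simp
qed

lemma ex_count_le_eq_size: "\<exists>t. count_le A t = size A \<and> count_le B t = size B"
proof -
  \<comment> \<open>Inserting 0 keeps the set nonempty when there are no zeros at all.\<close>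
  define t where "t = Max (insert 0 (set_mset (A + B)))"
  have "a \<le> t" if "a \<in># A + B" for a
    unfolding t_def using that by (intro Max_ge) auto
  then have "filter_mset (\<lambda>a. a \<le> t) A = A" "filter_mset (\<lambda>a. a \<le> t) B = B"
    by (auto intro!: filter_mset_eq_conv[THEN iffD2])
  then show ?thesis unfolding count_le_def by metis
qed

lemma ex_count_le_eq_zero: "\<exists>t. count_le A t = 0 \<and> count_le B t = 0"
proof -
  define t where "t = Min (insert 0 (set_mset (A + B))) - 1"
  have "\<not> a \<le> t" if "a \<in># A + B" for a
  proof -
    have "Min (insert 0 (set_mset (A + B))) \<le> a" using that by (intro Min_le) auto
    then show ?thesis by (simp add: t_def)
  qed
  then have "filter_mset (\<lambda>a. a \<le> t) A = {#}" "filter_mset (\<lambda>a. a \<le> t) B = {#}"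
    by auto
  then show ?thesis by (auto simp: count_le_def)
qed

text \<open>The limit of \<^const>\<open>angle_sum\<close> is a zero count only away from the zeros; since
  \<^const>\<open>count_le\<close> is right-continuous, such points suffice.\<close>

lemma ex_count_le_eq_right:
  "\<exists>s. s \<notin># A + B \<and> count_le A s = count_le A t \<and> count_le B s = count_le B t"
proof -
  define C where "C = set_mset (A + B) \<inter> {t<..}"
  \<comment> \<open>Halfway from \<open>t\<close> to the next element above it, or
    \<open>t + 1\<close> if there is none.\<close>
  define s where "s = (if C = {} then t + 1 else (t + Min C) / 2)"
  have fin: "finite C" by (simp add: C_def)
  have min: "Min C \<in> C" if "C \<noteq> {}" using that fin by simp
  have s: "t < s" "\<And>c. c \<in> C \<Longrightarrow> s < c"
  proof -
    show "t < s" using min by (cases "C = {}") (auto simp: s_def C_def)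
    show "s < c" if "c \<in> C" for c
    proof -
      have "Min C \<le> c" using fin that by simp
      moreover have "t < Min C" using min that unfolding C_def by blast
      ultimately show ?thesis using that by (auto simp: s_def)
    qed
  qed
  have "a \<le> s \<longleftrightarrow> a \<le> t" if "a \<in># A + B" for a
    using s(1) s(2)[of a] that unfolding C_def by fastforce
  then have "filter_mset (\<lambda>a. a \<le> s) A = filter_mset (\<lambda>a. a \<le> t) A"
    "filter_mset (\<lambda>a. a \<le> s) B = filter_mset (\<lambda>a. a \<le> t) B"
    by (auto intro!: filter_mset_cong)
  moreover have "s \<notin># A + B" using s unfolding C_def by fastforce
  ultimately show ?thesis unfolding count_le_def by metis
qed

text \<open>The first hypothesis at the i-th entry of the list of \<open>B\<close> gives one half of
  the chain; the second at entry i + 1 of the list of \<open>A\<close> gives the other.\<close>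

lemma alternating_chain_count_le:
  assumes BA: "\<And>t. count_le B t \<le> count_le A t" and AB: "\<And>t. count_le A t \<le> Suc (count_le B t)"
  shows "alternating_chain (sorted_list_of_multiset A) (sorted_list_of_multiset B)"
proof -
  have len: "length (sorted_list_of_multiset X) = size X" for X :: "real multiset"
    by (metis mset_sorted_list_of_multiset size_mset)
  \<comment> \<open>Beyond all elements the counts are the sizes, so the hypotheses give the
    condition on the lengths.\<close>
  obtain t where t: "count_le A t = size A" "count_le B t = size B"
    using ex_count_le_eq_size by blast
  have size: "size B \<le> size A" "size A \<le> Suc (size B)" using BA[of t] AB[of t] t by auto
  show ?thesis unfolding alternating_chain_def len
  proof (intro conjI allI impI)
    show "size A = size B \<or> size A = Suc (size B)" using size by auto
    fix i
    let ?as = "sorted_list_of_multiset A" and ?bs = "sorted_list_of_multiset B"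
    show "?as ! i \<le> ?bs ! i" if i: "i < size B"
    proof -
      have "i < count_le B (?bs ! i)"
        using nth_sorted_list_of_multiset_le_iff[OF i, of "?bs ! i"] by simp
      then show ?thesis
        using nth_sorted_list_of_multiset_le_iff[of i A "?bs ! i"] BA[of "?bs ! i"] i size by simp
    qed
    show "?bs ! i \<le> ?as ! Suc i" if i: "Suc i < size A"
    proof -
      have "Suc i < count_le A (?as ! Suc i)"
        using nth_sorted_list_of_multiset_le_iff[OF i, of "?as ! Suc i"] by simp
      then show ?thesis
        using nth_sorted_list_of_multiset_le_iff[of i B "?as ! Suc i"] AB[of "?as ! Suc i"] i size by simp
    qed
  qed
qed

text \<open>Far to the left the difference of the counts is 0, so all its values lie in {-1, 0, 1},
  and variation at most 1 forbids taking both 1 and -1. Which of them is excluded decides which list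
  starts the chain.\<close>

lemma alternating_chain_if_variation_le_1:
  assumes var: "\<And>s t. \<bar>(int (count_le A s) - int (count_le B s)) - (int (count_le A t) - int (count_le B t))\<bar> \<le> 1"
  shows "alternating_chain (sorted_list_of_multiset A) (sorted_list_of_multiset B) \<or>
    alternating_chain (sorted_list_of_multiset B) (sorted_list_of_multiset A)"
proof -
  obtain t0 where t0: "count_le A t0 = 0" "count_le B t0 = 0"
    using ex_count_le_eq_zero by blast
  have near: "count_le A t \<le> Suc (count_le B t)" "count_le B t \<le> Suc (count_le A t)" for t
    using var[of t t0] t0 by auto
  show ?thesis
  proof (cases "\<exists>s. count_le A s > count_le B s")
    case True
    then obtain s where s: "count_le A s > count_le B s" by blast
    then have "count_le B t \<le> count_le A t" for t using var[of s t] by linarith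
    then show ?thesis using alternating_chain_count_le[of B A] near by blast
  next
    case False
    then have "count_le A t \<le> count_le B t" for t by (meson not_le_imp_less)
    then show ?thesis using alternating_chain_count_le[of A B] near by blast
  qed
qed

section \<open>Hyperbolic polynomials on the upper half plane\<close>

lemma map_poly_of_real_linear_mult:
  "map_poly complex_of_real ([:- a, 1:] * q) = [:- complex_of_real a, 1:] * map_poly complex_of_real q"
  by (rule poly_eqI) (simp add: coeff_map_poly coeff_pCons mult_pCons_left split: nat.split)

text \<open>A complex root exists in positive degree and is real by hyperbolicity, so its linear
  factor splits off over the reals.\<close>

lemma hyperbolic_factorization:
  "hyperbolic p \<Longrightarrow> \<exists>c. c \<noteq> 0 \<and> (\<forall>z. poly (map_poly complex_of_real p) z =
      complex_of_real c * (\<Prod>a\<in>#proots p. z - of_real a))"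
proof (induction "degree p" arbitrary: p)
  case 0
  then obtain c where c: "p = [:c:]" using degree_eq_zeroE by metis
  then have "c \<noteq> 0" using 0 by (auto simp: hyperbolic_def)
  then show ?case using c by (intro exI[of _ c]) (simp add: map_poly_pCons)
next
  case (Suc n)
  have "degree (map_poly complex_of_real p) = Suc n"
    using Suc.hyps(2) by (simp add: degree_map_poly)
  then have nonconst: "\<not> constant (poly (map_poly complex_of_real p))"
    by (simp add: constant_degree)
  obtain z where z: "poly (map_poly complex_of_real p) z = 0"
    using Fundamental_Theorem_Algebra.fundamental_theorem_of_algebra[OF nonconst] by auto
  then obtain a where a: "z = of_real a"
    using Suc.prems unfolding hyperbolic_def by (metis Reals_cases)
  have "poly (map_poly complex_of_real p) (of_real a) = of_real (poly p a)"
    by (induction p) (auto simp: map_poly_pCons)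
  then have "[:-a, 1:] dvd p" using z a by (simp flip: poly_eq_0_iff_dvd)
  then obtain q where q: "p = [:-a, 1:] * q" by (elim dvdE)
  have p0: "p \<noteq> 0" using Suc.prems by (simp add: hyperbolic_def)
  then have q0: "q \<noteq> 0" using q by auto
  have eval: "poly (map_poly complex_of_real p) z = (z - of_real a) * poly (map_poly complex_of_real q) z" for z
    unfolding q map_poly_of_real_linear_mult by (simp add: algebra_simps)
  have "hyperbolic q"
    using Suc.prems q0 unfolding hyperbolic_def eval by auto
  moreover have "degree q = n" using Suc.hyps(2) q0 unfolding q by (simp add: degree_mult_eq del: mult_pCons_left)
  ultimately obtain c where c: "c \<noteq> 0" "\<And>z. poly (map_poly complex_of_real q) z =
      complex_of_real c * (\<Prod>a\<in>#proots q. z - of_real a)"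
    using Suc.hyps(1)[of q] by blast
  have "proots p = add_mset a (proots q)"
    unfolding q using q0 by (subst proots_mult) auto
  then show ?case using c unfolding eval by (intro exI[of _ c]) auto
qed

text \<open>The hypothesis is Im (p/q) >= 0 multiplied by |q|^2, which avoids dividing by
  zero.\<close>

lemma zeros_interlace_if_Im_nonneg:
  assumes p: "hyperbolic p" and q: "hyperbolic q"
    and im: "\<And>z. 0 < Im z \<Longrightarrow>
      0 \<le> Im (poly (map_poly complex_of_real p) z * cnj (poly (map_poly complex_of_real q) z))"
  shows "zeros_interlace q p"
proof -
  define A where "A = proots p"
  define B where "B = proots q"
  obtain c where c: "c \<noteq> 0" "\<And>z. poly (map_poly complex_of_real p) z =
      complex_of_real c * (\<Prod>a\<in>#A. z - of_real a)"
    using hyperbolic_factorization[OF p] A_def by blast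
  obtain d where d: "d \<noteq> 0" "\<And>z. poly (map_poly complex_of_real q) z =
      complex_of_real d * (\<Prod>a\<in>#B. z - of_real a)"
    using hyperbolic_factorization[OF q] B_def by blast
  \<comment> \<open>The argument of p/q along the line of height \<open>y\<close>, up to the sign of
    the leading constants; \<open>c * d\<close> carries that sign below.\<close>
  define h where "h = (\<lambda>y x. angle_sum A y x - angle_sum B y x)"
  have sgn: "0 \<le> (c * d) * sin (h y x)" if y: "0 < y" for x y
  proof -
    obtain r where r: "0 < r" "(\<Prod>a\<in>#A. Complex x y - of_real a) = rcis r (angle_sum A y x)"
      using prod_mset_eq_rcis_angle_sum[OF y] by blast
    obtain s where s: "0 < s" "(\<Prod>a\<in>#B. Complex x y - of_real a) = rcis s (angle_sum B y x)"
      using prod_mset_eq_rcis_angle_sum[OF y] by blast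
    have "cnj (rcis s t) = rcis s (- t)" for s t by (simp add: complex_eq_iff)
    then have "poly (map_poly complex_of_real p) (Complex x y) *
        cnj (poly (map_poly complex_of_real q) (Complex x y)) =
        complex_of_real (c * d) * rcis (r * s) (h y x)"
      unfolding c(2) d(2) r(2) s(2) by (simp add: h_def rcis_mult[of r _ s "- _", simplified] mult_ac flip: rcis_mult)
    then have "0 \<le> Im (complex_of_real (c * d) * rcis (r * s) (h y x))"
      using im[of "Complex x y"] y by simp
    then have "0 \<le> (r * s) * ((c * d) * sin (h y x))" by (simp add: mult_ac)
    then show ?thesis using r(1) s(1) by (metis mult_pos_pos zero_le_mult_iff not_le)
  qed
  have hvar: "\<bar>h y s - h y t\<bar> \<le> pi" if y: "0 < y" and st: "s \<le> t" for y s t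
    using y c(1) d(1) st sgn unfolding h_def
    by (intro sin_sign_imp_variation_le_pi[where c = "c * d"] continuous_intros continuous_on_angle_sum) auto
  let ?E = "\<lambda>t. int (count_le A t) - int (count_le B t)"
  have var0: "\<bar>?E s - ?E t\<bar> \<le> 1" if st: "s \<le> t" "s \<notin># A + B" "t \<notin># A + B" for s t
  proof -
    let ?l = "\<lambda>X t. pi * (real (size X) - real (count_le X t))"
    have "((\<lambda>y. \<bar>h y s - h y t\<bar>) \<longlongrightarrow> \<bar>(?l A s - ?l B s) - (?l A t - ?l B t)\<bar>) (at_right 0)"
      unfolding h_def using st by (intro tendsto_intros tendsto_angle_sum) auto
    moreover have "eventually (\<lambda>y. \<bar>h y s - h y t\<bar> \<le> pi) (at_right 0)"
      using hvar st(1) by (auto simp: eventually_at_filter intro!: always_eventually)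
    ultimately have "\<bar>(?l A s - ?l B s) - (?l A t - ?l B t)\<bar> \<le> pi"
      by (rule tendsto_upperbound) simp
    \<comment> \<open>The sizes cancel, leaving pi times the change of \<open>?E\<close>, an
      integer.\<close>
    also have "(?l A s - ?l B s) - (?l A t - ?l B t) = pi * of_int (?E t - ?E s)"
      by (simp add: algebra_simps)
    finally have "\<bar>of_int (?E t - ?E s) :: real\<bar> \<le> 1" by (simp add: abs_mult)
    then show ?thesis by linarith
  qed
  have "\<bar>?E s - ?E t\<bar> \<le> 1" for s t
  proof -
    obtain s' where s': "s' \<notin># A + B" "count_le A s' = count_le A s" "count_le B s' = count_le B s"
      using ex_count_le_eq_right by blast
    obtain t' where t': "t' \<notin># A + B" "count_le A t' = count_le A t" "count_le B t' = count_le B t"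
      using ex_count_le_eq_right by blast
    show ?thesis using var0[of s' t'] var0[of t' s'] s' t' by (cases "s' \<le> t'") auto
  qed
  then have "alternating_chain (sorted_list_of_multiset A) (sorted_list_of_multiset B) \<or>
    alternating_chain (sorted_list_of_multiset B) (sorted_list_of_multiset A)"
    by (rule alternating_chain_if_variation_le_1)
  then show ?thesis
    using p q unfolding zeros_interlace_def sorted_zeros_def A_def B_def by blast
qed

section \<open>Hermitian pencils\<close>

definition quad :: "(nat \<Rightarrow> nat \<Rightarrow> complex) \<Rightarrow> nat set \<Rightarrow> (nat \<Rightarrow> complex) \<Rightarrow> complex" where
  "quad M U v = (\<Sum>i\<in>U. \<Sum>k\<in>U. cnj (v i) * M i k * v k)"

definition hermitian_on :: "(nat \<Rightarrow> nat \<Rightarrow> complex) \<Rightarrow> nat set \<Rightarrow> bool" where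
  "hermitian_on M U \<longleftrightarrow> (\<forall>i\<in>U. \<forall>k\<in>U. cnj (M i k) = M k i)"

lemma hermitian_on_subset: "hermitian_on M U \<Longrightarrow> W \<subseteq> U \<Longrightarrow> hermitian_on M W"
  by (auto simp: hermitian_on_def)

lemma Im_quad_hermitian:
  assumes "hermitian_on M U"
  shows "Im (quad M U v) = 0"
proof -
  have "cnj (quad M U v) = (\<Sum>i\<in>U. \<Sum>k\<in>U. v i * M k i * cnj (v k))"
    unfolding quad_def cnj_sum using assms
    by (intro sum.cong refl) (simp add: hermitian_on_def)
  also have "\<dots> = quad M U v"
    unfolding quad_def by (subst sum.swap) (simp add: mult_ac)
  finally show ?thesis by (simp add: complex_eq_iff)
qed

lemma pdet_transpose:
  assumes S: "finite S"
  shows "pdet (\<lambda>i k. M k i) S = pdet M S"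
proof -
  have "pdet (\<lambda>i k. M k i) S =
      (\<Sum>p | p permutes S. of_int (sign (Hilbert_Choice.inv p)) * (\<Prod>i\<in>S. M (Hilbert_Choice.inv p i) i))"
    unfolding pdet_def by (rule sum_permutations_inverse)
  also have "\<dots> = pdet M S" unfolding pdet_def
  proof (intro sum.cong refl arg_cong2[of _ _ _ _ "(*)"])
    fix p assume "p \<in> {p. p permutes S}"
    then have p: "p permutes S" by simp
    show "of_int (sign (Hilbert_Choice.inv p)) = (of_int (sign p) :: 'a)"
      using p S permutes_imp_permutation sign_inverse by metis
    have "(\<Prod>i\<in>S. M (Hilbert_Choice.inv p i) i) = (\<Prod>i\<in>S. M (Hilbert_Choice.inv p (p i)) (p i))"
      using prod.permute[OF p, of "\<lambda>i. M (Hilbert_Choice.inv p i) i"] by (simp add: o_def)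
    then show "(\<Prod>i\<in>S. M (Hilbert_Choice.inv p i) i) = (\<Prod>i\<in>S. M i (p i))"
      using p by (simp add: permutes_inverses)
  qed
  finally show ?thesis .
qed

text \<open>Conjugating the entries of a Hermitian matrix transposes it, and \<open>pdet\<close> is
  invariant under transposition.\<close>

lemma pdet_hermitian_real:
  assumes M: "hermitian_on M U" and S: "S \<subseteq> U" "finite U"
  shows "of_real (Re (pdet M S)) = pdet M S"
proof -
  have fin: "finite S" using S finite_subset by auto
  have "cnj (pdet M S) = pdet (\<lambda>i k. cnj (M i k)) S"
    unfolding pdet_def by simp
  also have "\<dots> = pdet (\<lambda>i k. M k i) S"
    using M S by (intro pdet_cong) (auto simp: hermitian_on_def)
  finally have "cnj (pdet M S) = pdet M S" using pdet_transpose[OF fin] by metis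
  then show ?thesis by (simp add: complex_eq_iff)
qed

section \<open>Perturbation to dissipative matrices and the limit e -> 0\<close>

definition perturb :: "(nat \<Rightarrow> nat \<Rightarrow> complex) \<Rightarrow> complex \<Rightarrow> real \<Rightarrow> nat \<Rightarrow> nat \<Rightarrow> complex" where
  "perturb M z e i k = z * M i k + of_real e * (if i = k then \<i> else 0)"

lemma perturb_0 [simp]: "perturb M z 0 = (\<lambda>i k. z * M i k)"
  by (simp add: perturb_def fun_eq_iff)

text \<open>The form of a Hermitian matrix is real, so the perturbed one has imaginary part Im z
  times that form plus e |v|^2. The product in \<open>pos\<close> serves two uses: a positive
  semidefinite matrix with Im z > 0, and an arbitrary Hermitian one with z = 1.\<close>

lemma dissipative_perturb:
  assumes M: "hermitian_on M U" and U: "finite U" and e: "0 < e"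
    and pos: "\<And>v. 0 \<le> Im z * Re (quad M U v)"
  shows "dissipative (perturb M z e) U"
  unfolding dissipative_def
proof (intro allI impI)
  fix v :: "nat \<Rightarrow> complex" assume v: "\<exists>i\<in>U. v i \<noteq> 0"
  have "(\<Sum>i\<in>U. \<Sum>k\<in>U. cnj (v i) * perturb M z e i k * v k) =
      z * quad M U v + (\<Sum>i\<in>U. \<Sum>k\<in>U. if k = i then of_real e * \<i> * (cnj (v i) * v i) else 0)"
    unfolding quad_def sum_distrib_left sum.distrib[symmetric]
    by (intro sum.cong refl) (auto simp: perturb_def algebra_simps)
  also have "(\<Sum>i\<in>U. \<Sum>k\<in>U. if k = i then of_real e * \<i> * (cnj (v i) * v i) else 0) =
      \<i> * of_real (e * (\<Sum>i\<in>U. (cmod (v i))\<^sup>2))"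
    using U by (simp add: complex_norm_square sum_distrib_left mult_ac del: of_real_power)
  finally have "Im (\<Sum>i\<in>U. \<Sum>k\<in>U. cnj (v i) * perturb M z e i k * v k) =
      Im z * Re (quad M U v) + e * (\<Sum>i\<in>U. (cmod (v i))\<^sup>2)"
    using Im_quad_hermitian[OF M] by (simp del: of_real_power of_real_sum)
  moreover have "0 < (\<Sum>i\<in>U. (cmod (v i))\<^sup>2)"
    using v U by (auto intro!: sum_pos2)
  ultimately show "0 < Im (\<Sum>i\<in>U. \<Sum>k\<in>U. cnj (v i) * perturb M z e i k * v k)"
    using pos[of v] e by (simp add: add_nonneg_pos)
qed

definition mixdet_perturb ::
  "(nat \<Rightarrow> nat \<Rightarrow> complex) \<Rightarrow> (nat \<Rightarrow> nat \<Rightarrow> complex) \<Rightarrow> nat set \<Rightarrow> real \<Rightarrow> complex \<Rightarrow> complex" where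
  "mixdet_perturb M N V e z = mixdet (perturb M z e) (perturb N 1 e) V"

lemma continuous_on_mixdet_perturb:
  assumes "continuous_on X f" "continuous_on X g"
  shows "continuous_on X (\<lambda>x. mixdet_perturb M N V (f x) (g x))"
  unfolding mixdet_perturb_def mixdet_def pdet_def perturb_def
  by (intro continuous_intros assms)

lemma holomorphic_on_mixdet_perturb: "mixdet_perturb M N V e holomorphic_on X"
  unfolding mixdet_perturb_def mixdet_def pdet_def perturb_def
  by (intro holomorphic_intros)

lemma mixdet_perturb_0:
  "mixdet_perturb M N V 0 z =
    poly (\<Sum>S\<in>Pow V. monom (pdet M S * pdet N (V - S)) (card S)) z"
  unfolding mixdet_perturb_def mixdet_def
  by (simp add: pdet_scale poly_sum poly_monom mult_ac)

lemma mixdet_perturb_nonzero: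
  assumes V: "finite V" and M: "hermitian_on M V" and N: "hermitian_on N V"
    and psd: "\<And>v. 0 \<le> Re (quad M V v)" and e: "0 < e" and z: "0 < Im z"
  shows "mixdet_perturb M N V e z \<noteq> 0"
  unfolding mixdet_perturb_def using assms
  by (intro mixdet_dissipative_nonzero dissipative_perturb) auto

lemma Im_mixdet_perturb_nonneg:
  assumes V: "finite V" and M: "hermitian_on M V" and N: "hermitian_on N V"
    and psd: "\<And>v. 0 \<le> Re (quad M V v)" and e: "0 < e" and z: "0 < Im z" and j: "j \<in> V"
  shows "0 \<le> Im (mixdet_perturb M N V e z * cnj (mixdet_perturb M N (V - {j}) e z))"
proof (rule ccontr)
  let ?p = "mixdet_perturb M N V e z" and ?q = "mixdet_perturb M N (V - {j}) e z"
  assume neg: "\<not> 0 \<le> Im (?p * cnj ?q)"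
  then have q: "?q \<noteq> 0" by auto
  \<comment> \<open>Then \<open>w\<close> lies in the upper half plane and is a zero of \<open>?p + w * ?q\<close>, the value of \<open>mixdet\<close> at
    a pair of dissipative matrices.\<close>
  define w where "w = - ?p / ?q"
  have "w = - (?p * cnj ?q) / of_real ((cmod ?q)\<^sup>2)"
    using q by (simp add: w_def complex_norm_square field_simps del: of_real_power)
  then have "Im w = - Im (?p * cnj ?q) / (cmod ?q)\<^sup>2"
    by (simp add: Im_divide_of_real diff_divide_distrib del: of_real_power)
  then have w: "0 \<le> Im w" using neg by simp
  have "mixdet (perturb M z e) (\<lambda>i k. perturb N 1 e i k + (if i = j \<and> k = j then w else 0)) V \<noteq> 0"
    using assms w
    by (intro mixdet_dissipative_nonzero dissipative_add_diag dissipative_perturb) auto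
  then have "?p + w * ?q \<noteq> 0"
    unfolding mixdet_add_diag[OF V j] mixdet_perturb_def .
  then show False using q by (simp add: w_def)
qed

text \<open>A weak inequality survives the limit e -> 0 by continuity; nonvanishing does not and is
  treated separately.\<close>

lemma Im_mixdet_perturb_0_nonneg:
  assumes V: "finite V" and M: "hermitian_on M V" and N: "hermitian_on N V"
    and psd: "\<And>v. 0 \<le> Re (quad M V v)" and z: "0 < Im z" and j: "j \<in> V"
  shows "0 \<le> Im (mixdet_perturb M N V 0 z * cnj (mixdet_perturb M N (V - {j}) 0 z))"
proof -
  let ?g = "\<lambda>e. Im (mixdet_perturb M N V e z * cnj (mixdet_perturb M N (V - {j}) e z))"
  have "continuous_on UNIV ?g"
    by (intro continuous_intros continuous_on_mixdet_perturb)
  then have "(?g \<longlongrightarrow> ?g 0) (at 0)"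
    by (simp add: continuous_on_def)
  then have "(?g \<longlongrightarrow> ?g 0) (at_right 0)"
    by (rule tendsto_within_subset) simp
  moreover have "eventually (\<lambda>e. 0 \<le> ?g e) (at_right 0)"
    using Im_mixdet_perturb_nonneg[OF assms(1-4) _ z j]
    by (auto simp: eventually_at_filter intro!: always_eventually)
  ultimately show ?thesis by (rule tendsto_lowerbound) simp
qed

text \<open>Hurwitz's theorem on the upper half plane, applied with e = 1/(n+1). The point
  \<open>z1\<close> may lie anywhere; it only witnesses that the limit polynomial is not identically
  zero.\<close>

lemma mixdet_perturb_0_nonzero:
  assumes V: "finite V" and M: "hermitian_on M V" and N: "hermitian_on N V"
    and psd: "\<And>v. 0 \<le> Re (quad M V v)" and z0: "0 < Im z0"
    and nz: "mixdet_perturb M N V 0 z1 \<noteq> 0"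
  shows "mixdet_perturb M N V 0 z0 \<noteq> 0"
proof
  assume 0: "mixdet_perturb M N V 0 z0 = 0"
  let ?H = "{z. 0 < Im z}" and ?f = "mixdet_perturb M N V"
  have H: "open ?H" "connected ?H" "z0 \<in> ?H"
    using z0 by (simp_all add: open_halfspace_Im_gt convex_halfspace_Im_gt convex_connected)
  \<comment> \<open>A constant limit would equal its value 0 at \<open>z0\<close>, giving a nonzero
    polynomial with infinitely many zeros.\<close>
  have nonconst: "\<not> ?f 0 constant_on ?H"
  proof
    assume "?f 0 constant_on ?H"
    then have zero: "?f 0 z = 0" if "z \<in> ?H" for z
      using that 0 H(3) unfolding constant_on_def by metis
    define P where "P = (\<Sum>S\<in>Pow V. monom (pdet M S * pdet N (V - S)) (card S))"
    have P: "?f 0 z = poly P z" for z unfolding mixdet_perturb_0 P_def ..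
    have "P \<noteq> 0" using nz P by auto
    then have "finite {z. poly P z = 0}" by (rule poly_roots_finite)
    then have "finite ?H" by (rule rev_finite_subset) (use zero P in auto)
    then show False using H by (metis empty_iff finite_imp_not_open)
  qed
  have "?f 0 z0 \<noteq> 0"
  proof (rule Hurwitz_no_zeros[of ?H "\<lambda>n. ?f (inverse (real (Suc n)))" "?f 0" z0])
    show "?f (inverse (real (Suc n))) z \<noteq> 0" if "z \<in> ?H" for n z
      using that by (intro mixdet_perturb_nonzero V M N psd) auto
    show "uniform_limit K (\<lambda>n. ?f (inverse (real (Suc n)))) (?f 0) sequentially"
      if K: "compact K" "K \<subseteq> ?H" for K
    proof (rule uniform_limitI)
      fix r :: real assume r: "0 < r"
      \<comment> \<open>Joint uniform continuity in (e, z) makes the convergence for e -> 0 uniform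
        in z.\<close>
      have "uniformly_continuous_on ({0..1} \<times> K) (\<lambda>x. ?f (fst x) (snd x))"
        using K by (intro compact_uniformly_continuous continuous_on_mixdet_perturb
            continuous_intros compact_Times) auto
      then obtain d where d: "0 < d" "\<And>x y. x \<in> {0..1} \<times> K \<Longrightarrow> y \<in> {0..1} \<times> K \<Longrightarrow>
          dist y x < d \<Longrightarrow> dist (?f (fst y) (snd y)) (?f (fst x) (snd x)) < r"
        using r unfolding uniformly_continuous_on_def by metis
      have "eventually (\<lambda>n. inverse (real (Suc n)) < d) sequentially"
        using LIMSEQ_inverse_real_of_nat d(1) by (rule order_tendstoD(2))
      then show "eventually (\<lambda>n. \<forall>z\<in>K. dist (?f (inverse (real (Suc n))) z) (?f 0 z) < r) sequentially"
      proof eventually_elim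
        case (elim n)
        show ?case
        proof
          fix z assume z: "z \<in> K"
          have "inverse (real (Suc n)) \<le> 1" by (simp add: inverse_le_1_iff)
          then show "dist (?f (inverse (real (Suc n))) z) (?f 0 z) < r"
            using d(2)[of "(0, z)" "(inverse (real (Suc n)), z)"] z elim
            by (simp add: dist_Pair_Pair)
        qed
      qed
    qed
  qed (use H nonconst in \<open>auto intro: holomorphic_on_mixdet_perturb\<close>)
  then show False using 0 by simp
qed

section \<open>The pencil as a real polynomial\<close>

definition mixdet_poly ::
  "(nat \<Rightarrow> nat \<Rightarrow> complex) \<Rightarrow> (nat \<Rightarrow> nat \<Rightarrow> complex) \<Rightarrow> nat set \<Rightarrow> real poly" where
  "mixdet_poly M N V = (\<Sum>S\<in>Pow V. monom (Re (pdet M S) * Re (pdet N (V - S))) (card S))"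

text \<open>The minors of Hermitian matrices are real, so the real parts taken in
  \<open>mixdet_poly\<close> lose nothing.\<close>

lemma map_poly_mixdet_poly:
  assumes V: "finite V" and M: "hermitian_on M V" and N: "hermitian_on N V"
  shows "map_poly complex_of_real (mixdet_poly M N V) =
    (\<Sum>S\<in>Pow V. monom (pdet M S * pdet N (V - S)) (card S))"
proof -
  have "map_poly complex_of_real (\<Sum>S\<in>X. monom (c S) (d S)) =
      (\<Sum>S\<in>X. monom (complex_of_real (c S)) (d S))" for X :: "nat set set" and c d
    by (rule poly_eqI) (auto simp: coeff_map_poly coeff_sum intro!: sum.cong)
  then show ?thesis unfolding mixdet_poly_def
    using pdet_hermitian_real[OF M _ V] pdet_hermitian_real[OF N _ V]
    by (auto intro!: sum.cong)
qed

lemma poly_mixdet_poly: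
  assumes "finite V" "hermitian_on M V" "hermitian_on N V"
  shows "poly (map_poly complex_of_real (mixdet_poly M N V)) z = mixdet_perturb M N V 0 z"
  unfolding map_poly_mixdet_poly[OF assms] mixdet_perturb_0 ..

text \<open>Zeros in the upper half plane are excluded by the limit argument, and those in the lower
  half plane because the coefficients are real.\<close>

lemma hyperbolic_mixdet_poly:
  assumes V: "finite V" and M: "hermitian_on M V" and N: "hermitian_on N V"
    and psd: "\<And>v. 0 \<le> Re (quad M V v)" and nz: "mixdet_poly M N V \<noteq> 0"
  shows "hyperbolic (mixdet_poly M N V)"
  unfolding hyperbolic_def
proof (intro conjI allI impI nz)
  let ?P = "map_poly complex_of_real (mixdet_poly M N V)"
  have "?P \<noteq> 0" using nz by (simp add: map_poly_eq_0_iff)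
  then obtain z1 where z1: "poly ?P z1 \<noteq> 0" using poly_all_0_iff_0 by blast
  have upper: "poly ?P z \<noteq> 0" if "0 < Im z" for z
    using mixdet_perturb_0_nonzero[OF V M N psd that, of z1] z1
    unfolding poly_mixdet_poly[OF V M N] by blast
  fix z assume z: "poly ?P z = 0"
  then have "poly ?P (cnj z) = 0"
    by (subst real_poly_cnj_root_iff) (auto simp: coeff_map_poly)
  then have "\<not> 0 < Im (cnj z)" "\<not> 0 < Im z" using upper z by blast+
  then show "z \<in> \<real>" by (simp add: complex_is_Real_iff)
qed

section \<open>Passage from matrices to index functions\<close>

lemma hermitian_imp_hermitian_on:
  assumes A: "A \<in> carrier_mat n n" and h: "hermitian A"
  shows "hermitian_on (\<lambda>i k. A $$ (i, k)) {0..<n}"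
  unfolding hermitian_on_def
proof (intro ballI)
  fix i k assume ik: "i \<in> {0..<n}" "k \<in> {0..<n}"
  have "mat_adjoint A $$ (k, i) = cnj (A $$ (i, k))"
    using A ik by (simp add: mat_adjoint_def mat_of_rows_index)
  then show "cnj (A $$ (i, k)) = A $$ (k, i)" using h by (simp add: hermitian_def)
qed

text \<open>The vector is extended by zero outside \<open>V\<close>, so principal submatrices
  inherit semidefiniteness.\<close>

lemma positive_semidefinite_imp_quad_nonneg:
  assumes A: "A \<in> carrier_mat n n" and psd: "positive_semidefinite A" and V: "V \<subseteq> {0..<n}"
  shows "0 \<le> Re (quad (\<lambda>i k. A $$ (i, k)) V v)"
proof -
  define u where "u = Matrix.vec n (\<lambda>i. if i \<in> V then v i else 0)"
  have u: "u \<in> carrier_vec n" by (simp add: u_def)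
  have "(A *\<^sub>v u) \<bullet>c u = (\<Sum>i\<in>{0..<n}. (\<Sum>k\<in>{0..<n}. A $$ (i, k) * u $ k) * cnj (u $ i))"
    using A u by (auto simp: scalar_prod_def intro!: sum.cong)
  also have "\<dots> = (\<Sum>i\<in>{0..<n}. \<Sum>k\<in>{0..<n}. cnj (u $ i) * A $$ (i, k) * u $ k)"
    by (simp add: sum_distrib_left sum_distrib_right mult_ac)
  also have "\<dots> = (\<Sum>i\<in>V. \<Sum>k\<in>{0..<n}. cnj (u $ i) * A $$ (i, k) * u $ k)"
    using V by (intro sum.mono_neutral_right) (auto simp: u_def)
  also have "\<dots> = (\<Sum>i\<in>V. \<Sum>k\<in>V. cnj (u $ i) * A $$ (i, k) * u $ k)"
    using V by (intro sum.cong refl sum.mono_neutral_right) (auto simp: u_def)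
  also have "\<dots> = quad (\<lambda>i k. A $$ (i, k)) V v"
    using V unfolding quad_def by (intro sum.cong refl) (auto simp: u_def subset_iff)
  finally show ?thesis using psd A u unfolding positive_semidefinite_def by force
qed

lemma principal_submatrix_full:
  assumes A: "A \<in> carrier_mat n n"
  shows "principal_submatrix A {0..<n} = A"
proof (rule eq_matI)
  have "principal_submatrix A {0..<n} \<in> carrier_mat n n"
    using principal_submatrix_carrier(1)[OF A subset_refl] by simp
  then show "dim_row (principal_submatrix A {0..<n}) = dim_row A"
    "dim_col (principal_submatrix A {0..<n}) = dim_col A" using A by auto
  fix i k assume ik: "i < dim_row A" "k < dim_col A"
  have pick: "pick {0..<n} l = l" if "l < n" for l
  proof -
    have "{a \<in> {0..<n}. a < l} = {0..<l}" using that by auto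
    then show ?thesis using pick_card_in_set[of l "{0..<n}"] that by simp
  qed
  show "principal_submatrix A {0..<n} $$ (i, k) = A $$ (i, k)"
    using principal_submatrix_carrier(2)[OF A subset_refl, of i k] ik A pick by simp
qed

theorem mainTheorem2:
  fixes A B :: "complex mat" and n j :: nat
  assumes "n \<ge> 1"
    and "A \<in> carrier_mat n n" and "B \<in> carrier_mat n n"
    and "hermitian A" and "hermitian B"
    and "positive_semidefinite A"
    and "eta_pencil A B \<noteq> 0"
    and "j < n"
  shows "\<exists>p q :: real poly.
           map_poly complex_of_real p = eta_pencil A B \<and>
           map_poly complex_of_real q =
             eta_pencil (principal_submatrix A ({0..<n} - {j})) (principal_submatrix B ({0..<n} - {j})) \<and>
           zeros_interlace q p"
proof -
  note A = assms(2) and B = assms(3)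
  let ?a = "\<lambda>i k. A $$ (i, k)" and ?b = "\<lambda>i k. - B $$ (i, k)"
  let ?U = "{0..<n}" and ?W = "{0..<n} - {j}"
  let ?P = "mixdet_poly ?a ?b"
  have ha: "hermitian_on ?a ?U" by (rule hermitian_imp_hermitian_on[OF A assms(4)])
  have hb: "hermitian_on ?b ?U"
    using hermitian_imp_hermitian_on[OF B assms(5)] by (simp add: hermitian_on_def)
  have ha': "hermitian_on ?a V" and hb': "hermitian_on ?b V" and fin: "finite V"
    and psd: "0 \<le> Re (quad ?a V v)" if "V \<subseteq> ?U" for V v
    using ha hb hermitian_on_subset that finite_subset[OF that]
      positive_semidefinite_imp_quad_nonneg[OF A assms(6) that] by auto
  have P: "map_poly complex_of_real (?P V) =
      eta_pencil (principal_submatrix A V) (principal_submatrix B V)" if "V \<subseteq> ?U" for V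
    using that by (simp add: map_poly_mixdet_poly fin ha' hb' eta_pencil_principal_submatrix[OF A B])
  have hyp: "hyperbolic (?P V)" if "V \<subseteq> ?U" "?P V \<noteq> 0" for V
    using that by (intro hyperbolic_mixdet_poly fin ha' hb' psd)
  have PU: "map_poly complex_of_real (?P ?U) = eta_pencil A B"
    using P[of ?U] by (simp add: principal_submatrix_full A B)
  then have PU0: "?P ?U \<noteq> 0" using assms(7) by auto
  have "zeros_interlace (?P ?W) (?P ?U)"
  proof (cases "?P ?W = 0")
    \<comment> \<open>The convention for the zero polynomial leaves only the hyperbolicity of the
      full polynomial to check.\<close>
    case True
    then show ?thesis using hyp[OF subset_refl PU0] by (simp add: zeros_interlace_def)
  next
    case False
    have "0 \<le> Im (poly (map_poly complex_of_real (?P ?U)) z *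
        cnj (poly (map_poly complex_of_real (?P ?W)) z))" if "0 < Im z" for z
      using Im_mixdet_perturb_0_nonneg[OF fin[OF subset_refl] ha hb psd[OF subset_refl] that, of j] assms(8)
      by (simp add: poly_mixdet_poly fin ha' hb')
    then show ?thesis
      using False PU0 by (intro zeros_interlace_if_Im_nonneg hyp) auto
  qed
  then show ?thesis using PU P[of ?W] by auto
qed

end
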